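(* Let $f:\mathbb{R}^d\to\mathbb{R}$ be twice differentiable and $\mu$-strongly convex with $\mu>0$, and let $\nabla f$ be Lipschitz continuous with constant $L>0$. Let $\kappa=L/\mu$ and let $x_*$ be the minimizer of $f$. Let $\{x_t\}_{t\ge 0}$ be the iterates generated by BFGS, where at every iteration the step size satisfies the Armijo-Wolfe conditions with parameters $\alpha,\beta$. Then for any initial point $x_0\in\mathbb{R}^d$ and any symmetric positive definite initial Hessian approximation matrix $B_0$, $$\frac{f(x_t)-f(x_* )}{f(x_0)-f(x_* )}\le\left(1-e^{-\frac{\Psi(\bar B_0)}{t}}\,\frac{2\alpha(1-\beta)}{\kappa}\right)^{t},\qquad\forall t\ge 1,$$ where $\bar B_0=\frac1L B_0$.
   Context: BFGS method: given $x_0\in\mathbb{R}^d$ and a symmetric positive definite $B_0\in\mathbb{R}^{d\times d}$, for $t\ge0$ set $g_t=\nabla f(x_t)$, $d_t=-B_t^{-1}g_t$, $x_{t+1}=x_t+\eta_t d_t$ with step size $\eta_t>0$, $s_t=x_{t+1}-x_t$, $y_t=\nabla f(x_{t+1})-\nabla f(x_t)$, and $$B_{t+1}=B_t-\frac{B_ts_ts_t^\top B_t}{s_t^\top B_ts_t}+\frac{y_ty_t^\top}{s_t^\top y_t}.$$ The iterates are assumed non-optimal ($g_t\neq0$), so that all quantities are well defined. Armijo-Wolfe conditions on $\eta_t$, with parameters $0<\alpha<\beta<1$ and $0<\alpha<\frac12$: $$f(x_t+\eta_td_t)\le f(x_t)+\alpha\eta_t\nabla f(x_t)^\top d_t,\qquad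 \nabla f(x_t+\eta_td_t)^\top d_t\ge\beta\nabla f(x_t)^\top d_t.$$ For symmetric positive definite $A\in\mathbb{R}^{d\times d}$, $\Psi(A):=\mathrm{Tr}(A)-d-\log\mathrm{Det}(A)$. *)

theory Defs
  imports "HOL-Analysis.Analysis"
begin

definition grad :: "('a::real_inner \<Rightarrow> real) \<Rightarrow> 'a \<Rightarrow> 'a" where
  "grad f x = (THE D. GDERIV f x :> D)"

lemma grad_eq: "grad f x = D" if "GDERIV f x :> D"
  unfolding grad_def
proof (rule the_equality)
  show "GDERIV f x :> D" by (rule that)
  show "E = D" if "GDERIV f x :> E" for E
  proof -
    have "(\<lambda>h. h \<bullet> E) = (\<lambda>h. h \<bullet> D)"
      using that \<open>GDERIV f x :> D\<close> unfolding gderiv_def by (rule has_derivative_unique)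
    then show ?thesis
      by (metis vector_eq_ldot)
  qed
qed

definition twice_differentiable :: "('a::real_inner \<Rightarrow> real) \<Rightarrow> bool" where
  "twice_differentiable f \<longleftrightarrow>
     (\<forall>x. f differentiable (at x)) \<and> (\<forall>x. grad f differentiable (at x))"

definition strongly_convex :: "real \<Rightarrow> ('a::real_inner \<Rightarrow> real) \<Rightarrow> bool" where
  "strongly_convex \<mu> f \<longleftrightarrow>
     (\<forall>x y. \<forall>u\<ge>0. \<forall>v\<ge>0. u + v = 1 \<longrightarrow>
        f (u *\<^sub>R x + v *\<^sub>R y) \<le> u * f x + v * f y - \<mu> / 2 * u * v * (norm (x - y))\<^sup>2)"

definition sym_pos_def :: "real^'n^'n \<Rightarrow> bool" where
  "sym_pos_def A \<longleftrightarrow> transpose A = A \<and> (\<forall>v. v \<noteq> 0 \<longrightarrow> 0 < v \<bullet> (A *v v))"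

text \<open>The matrix \<open>u v\<^sup>T\<close>, as the product of a \<open>d \<times> 1\<close> and a \<open>1 \<times> d\<close> matrix.\<close>

definition outer :: "real^'n \<Rightarrow> real^'n \<Rightarrow> real^'n^'n" where
  "outer u v = (columnvector u :: real^1^'n) ** (rowvector v :: real^'n^1)"

definition Psi :: "real^'n^'n \<Rightarrow> real" where
  "Psi A = trace A - real CARD('n) - ln (det A)"

definition bfgs_direction :: "(real^'n \<Rightarrow> real) \<Rightarrow> real^'n \<Rightarrow> real^'n^'n \<Rightarrow> real^'n" where
  "bfgs_direction f x B = - (matrix_inv B *v grad f x)"

definition bfgs_update :: "real^'n^'n \<Rightarrow> real^'n \<Rightarrow> real^'n \<Rightarrow> real^'n^'n" where
  "bfgs_update B s y =
     B - (1 / (s \<bullet> (B *v s))) *\<^sub>R (B ** outer s s ** B) + (1 / (s \<bullet> y)) *\<^sub>R outer y y"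

text \<open>A run of BFGS with step sizes \<open>\<eta>\<close>, iterates \<open>x\<close> and Hessian approximations \<open>B\<close>,
  started at \<open>x 0\<close> and \<open>B 0\<close>. Non-optimality of all iterates is part of the setting.\<close>

definition bfgs_run ::
  "(real^'n \<Rightarrow> real) \<Rightarrow> (nat \<Rightarrow> real) \<Rightarrow> (nat \<Rightarrow> real^'n) \<Rightarrow> (nat \<Rightarrow> real^'n^'n) \<Rightarrow> bool" where
  "bfgs_run f \<eta> x B \<longleftrightarrow>
     sym_pos_def (B 0) \<and>
     (\<forall>t. grad f (x t) \<noteq> 0 \<and> 0 < \<eta> t \<and>
          x (Suc t) = x t + \<eta> t *\<^sub>R bfgs_direction f (x t) (B t) \<and>
          B (Suc t) = bfgs_update (B t) (x (Suc t) - x t) (grad f (x (Suc t)) - grad f (x t)))"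

definition armijo_wolfe ::
  "real \<Rightarrow> real \<Rightarrow> (real^'n \<Rightarrow> real) \<Rightarrow> real^'n \<Rightarrow> real^'n \<Rightarrow> real \<Rightarrow> bool" where
  "armijo_wolfe \<alpha> \<beta> f x d \<eta> \<longleftrightarrow>
     f (x + \<eta> *\<^sub>R d) \<le> f x + \<alpha> * \<eta> * (grad f x \<bullet> d) \<and>
     grad f (x + \<eta> *\<^sub>R d) \<bullet> d \<ge> \<beta> * (grad f x \<bullet> d)"

end

theory Submission
  imports Defs
begin

text \<open>
  Write \<open>g\<^sub>t\<close>, \<open>s\<^sub>t\<close>, \<open>y\<^sub>t\<close> for the gradient, the step and the change of the gradient, and put
  \<open>a\<^sub>t = L (g\<^sub>t \<bullet> s\<^sub>t)\<^sup>2 / (\<parallel>g\<^sub>t\<parallel>\<^sup>2 (s\<^sub>t \<bullet> y\<^sub>t))\<close>. This number measures the quality of step \<open>t\<close>: it is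
  \<open>cos\<^sup>2 \<theta>\<^sub>t\<close>, with \<open>\<theta>\<^sub>t\<close> the angle between the step and the negative gradient, divided by the
  curvature \<open>(s\<^sub>t \<bullet> y\<^sub>t) / (L \<parallel>s\<^sub>t\<parallel>\<^sup>2)\<close> along the step.

  A single step multiplies the optimality gap by at most \<open>1 - c a\<^sub>t\<close>, where
  \<open>c = 2 \<alpha> (1 - \<beta>) / \<kappa>\<close>: the sufficient-decrease condition turns \<open>- g\<^sub>t \<bullet> s\<^sub>t\<close> into progress, the
  curvature condition bounds \<open>- g\<^sub>t \<bullet> s\<^sub>t\<close> below in terms of \<open>a\<^sub>t \<parallel>g\<^sub>t\<parallel>\<^sup>2\<close>, and strong convexity bounds
  the gap by \<open>\<parallel>g\<^sub>t\<parallel>\<^sup>2 / (2 \<mu>)\<close> (\<open>suboptimality_contraction\<close>).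

  Individual steps may be poor, but not many of them. The trace and the determinant of a BFGS update
  have closed forms, and together with \<open>ln u \<le> u - 1\<close> they show that the potential \<open>\<Psi>\<close> of the scaled
  matrix \<open>B\<^sub>t / L\<close> grows by at most \<open>ln a\<^sub>t\<close> in step \<open>t\<close> (\<open>Psi_bfgs_update_le\<close>). The scaling by \<open>1 / L\<close>
  is what makes the remaining term \<open>\<parallel>y\<^sub>t\<parallel>\<^sup>2 / (L (s\<^sub>t \<bullet> y\<^sub>t)) - 1\<close> nonpositive, by cocoercivity of the
  gradient. Since \<open>\<Psi>\<close> is never negative, \<open>ln a\<^sub>0 + \<dots> + ln a\<^sub>t\<^sub>-\<^sub>1 \<ge> - \<Psi> (B\<^sub>0 / L)\<close>: the geometric mean of
  the \<open>a\<^sub>i\<close> is at least \<open>exp (- \<Psi> (B\<^sub>0 / L) / t)\<close>. Two applications of the inequality between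
  arithmetic and geometric means then bound the product of the factors \<open>1 - c a\<^sub>i\<close>
  (\<open>prod_one_minus_le_power\<close>).

  Nonnegativity of \<open>\<Psi>\<close> and positivity of the determinant are proved without eigenvalues. The update
  with \<open>s = y = e\<^sub>i\<close> makes \<open>e\<^sub>i\<close> a fixed vector and keeps the coordinate vectors that were fixed before,
  so updating along all coordinates turns any symmetric positive definite matrix into the identity
  (\<open>sym_pos_def_bfgs_induct\<close>); along this path \<open>\<Psi>\<close> does not increase, and it ends at \<open>\<Psi> 1 = 0\<close>.
\<close>

section \<open>A rank-one determinant\<close>

lemma outer_component: "outer u v $ i $ j = u $ i * v $ j"
  by (simp add: outer_def matrix_matrix_mult_def columnvector_def rowvector_def)

lemma outer_mult_vec: "outer u v *v z = (v \<bullet> z) *\<^sub>R u"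
  by (simp add: vec_eq_iff matrix_vector_mult_def outer_component inner_vec_def
      sum_distrib_left sum_distrib_right mult_ac)

lemma trace_outer: "trace (outer u v) = u \<bullet> v"
  by (simp add: trace_def outer_component inner_vec_def)

lemma trace_scaleR: "trace (c *\<^sub>R A :: real^'n^'n) = c * trace A"
  by (simp add: trace_def sum_distrib_left)

text \<open>Expanding row \<open>k\<close> of \<open>1 + w s\<^sup>T\<close> by linearity gives a matrix that has \<open>s\<close> itself as row \<open>k\<close>. That
  row can be subtracted from all others, which removes the shifts \<open>w\<^sub>i s\<close>; what remains is the
  identity with one row replaced, as in Cramer's rule.\<close>

lemma det_identity_with_shifted_rows_and_pivot:
  fixes w s :: "real^'n"
  assumes "finite S" "k \<notin> S"
  shows "det (\<chi> i. if i = k then s else if i \<in> S then axis i 1 + w $ i *\<^sub>R s else axis i 1) = s $ k"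
  using assms
proof (induction S rule: finite_induct)
  case empty
  have "(\<Sum>i\<in>UNIV. s $ i *s row i (mat 1 :: real^'n^'n)) = s"
    by (simp add: vec_eq_iff row_def mat_def if_distrib cong: if_cong)
  moreover have "row i (mat 1 :: real^'n^'n) = axis i 1" for i
    by (simp add: vec_eq_iff row_def mat_def axis_def)
  ultimately show ?case
    using cramer_lemma_transpose[of k s "mat 1"] by (simp only: empty_iff if_False det_I mult_1_right)
next
  case (insert j S)
  define M where
    "M = (\<chi> i. if i = k then s else if i \<in> S then axis i 1 + w $ i *\<^sub>R s else axis i 1)"
  have jk: "j \<noteq> k" and k: "k \<notin> S" using insert.prems by auto
  have "(\<chi> i. if i = k then s else if i \<in> insert j S then axis i 1 + w $ i *\<^sub>R s else axis i 1)
      = (\<chi> i. if i = j then row j M + w $ j *s row k M else row i M)"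
    using insert.hyps jk
    by (auto simp: M_def vec_eq_iff row_def scalar_mult_eq_scaleR)
  then show ?case
    using det_row_operation[OF jk, of M "w $ j"] insert.IH[OF k] by (simp add: M_def)
qed

text \<open>The shifts are added one row at a time, so that multilinearity applies to a single row in each
  step of the induction.\<close>

lemma det_identity_with_shifted_rows:
  fixes w s :: "real^'n"
  assumes "finite S"
  shows "det (\<chi> i. if i \<in> S then axis i 1 + w $ i *\<^sub>R s else axis i 1) = 1 + (\<Sum>i\<in>S. w $ i * s $ i)"
  using assms
proof (induction S rule: finite_induct)
  case empty
  have "(\<chi> i. axis i 1) = (mat 1 :: real^'n^'n)"
    by (simp add: vec_eq_iff mat_def axis_def)
  then show ?case by simp
next
  case (insert k S)
  define c where "c i = (if i \<in> S then axis i 1 + w $ i *\<^sub>R s else axis i 1)" for i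
  have split: "(\<chi> i. if i \<in> insert k S then axis i 1 + w $ i *\<^sub>R s else axis i 1)
      = (\<chi> i. if i = k then axis k 1 + w $ k *s s else c i)"
    by (auto simp: c_def vec_eq_iff scalar_mult_eq_scaleR)
  have unit: "(\<chi> i. if i = k then axis k 1 else c i) = (\<chi> i. c i)"
    using insert.hyps by (auto simp: c_def vec_eq_iff)
  have pivot: "det (\<chi> i. if i = k then s else c i) = s $ k"
    unfolding c_def by (rule det_identity_with_shifted_rows_and_pivot) (use insert.hyps in auto)
  have "det (\<chi> i. if i = k then axis k 1 + w $ k *s s else c i)
      = det (\<chi> i. c i) + w $ k * s $ k"
    using det_row_add[of k "\<lambda>_. axis k 1" "\<lambda>_. w $ k *s s" c]
      det_row_mul[of k "w $ k" "\<lambda>_. s" c] by (simp only: unit pivot)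
  moreover have "det (\<chi> i. c i) = 1 + (\<Sum>i\<in>S. w $ i * s $ i)"
    unfolding c_def by (rule insert.IH)
  ultimately show ?case using insert.hyps by (simp only: split sum.insert) simp
qed

lemma det_identity_plus_outer:
  fixes w s :: "real^'n"
  shows "det (mat 1 + outer w s) = 1 + w \<bullet> s"
proof -
  have "mat 1 + outer w s = (\<chi> i. if i \<in> UNIV then axis i 1 + w $ i *\<^sub>R s else axis i 1)"
    by (auto simp: vec_eq_iff mat_def axis_def outer_component)
  then show ?thesis
    using det_identity_with_shifted_rows[of UNIV w s] by (simp add: inner_vec_def)
qed

section \<open>The BFGS update\<close>

lemma sym_pos_def_inner_commute:
  assumes "sym_pos_def B"
  shows "u \<bullet> (B *v v) = (B *v u) \<bullet> v"
  using assms dot_lmul_matrix[of u B v]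
  by (metis sym_pos_def_def transpose_matrix_vector)

lemma sym_pos_def_pos: "sym_pos_def B \<Longrightarrow> v \<noteq> 0 \<Longrightarrow> 0 < v \<bullet> (B *v v)"
  by (simp add: sym_pos_def_def)

lemma sym_pos_def_mult_nonzero: "sym_pos_def B \<Longrightarrow> v \<noteq> 0 \<Longrightarrow> B *v v \<noteq> 0"
  using sym_pos_def_pos[of B v] by auto

lemma sym_pos_def_scaleR:
  assumes "sym_pos_def B" "c > 0"
  shows "sym_pos_def (c *\<^sub>R B)"
  using assms by (simp add: sym_pos_def_def transpose_scalar flip: scaleR_matrix_vector_assoc)

lemma sym_pos_def_mult_matrix_inv:
  assumes "sym_pos_def B"
  shows "B *v (matrix_inv B *v v) = v"
proof -
  have "invertible B"
    unfolding invertible_left_inverse matrix_left_invertible_ker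
    using sym_pos_def_mult_nonzero[OF assms] by blast
  then have "B ** matrix_inv B = mat 1"
    unfolding invertible_def matrix_inv_def by (rule someI2_ex) simp
  then show ?thesis
    by (simp add: matrix_vector_mul_assoc)
qed

lemma bfgs_rank_one_term:
  assumes "sym_pos_def B"
  shows "B ** outer s s ** B = outer (B *v s) (B *v s)"
  unfolding matrix_eq
proof
  fix v
  have "(B ** outer s s ** B) *v v = B *v (outer s s *v (B *v v))"
    by (simp only: matrix_vector_mul_assoc matrix_mul_assoc)
  also have "\<dots> = outer (B *v s) (B *v s) *v v"
    by (simp only: outer_mult_vec matrix_vector_mult_scaleR sym_pos_def_inner_commute[OF assms, of s v])
  finally show "(B ** outer s s ** B) *v v = outer (B *v s) (B *v s) *v v" .
qed

lemma bfgs_update_mult_vec: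
  assumes "sym_pos_def B"
  shows "bfgs_update B s y *v v = B *v v - ((B *v s) \<bullet> v / (s \<bullet> (B *v s))) *\<^sub>R (B *v s)
    + (y \<bullet> v / (s \<bullet> y)) *\<^sub>R y"
  unfolding bfgs_update_def bfgs_rank_one_term[OF assms] matrix_vector_mult_add_rdistrib
    matrix_vector_mult_diff_rdistrib scaleR_matrix_vector_assoc[symmetric] outer_mult_vec
  by simp

text \<open>The update is a congruence \<open>A B A\<^sup>T\<close> by a rank-one perturbation \<open>A = 1 + w s\<^sup>T\<close> of the identity.
  Both the determinant formula and the preservation of positive definiteness follow from it at once.
  The vector \<open>w\<close> is found by comparing coefficients: expanding \<open>(1 + w s\<^sup>T) B (1 + s w\<^sup>T)\<close>, the part of
  \<open>w\<close> along \<open>B s\<close> is fixed by cancelling the mixed terms in \<open>y\<close> and \<open>B s\<close>, and the part along \<open>y\<close> by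
  the coefficient of \<open>y y\<^sup>T\<close>.\<close>

lemma bfgs_update_product_form:
  fixes B :: "real^'n^'n"
  assumes B: "sym_pos_def B" and sy: "s \<bullet> y > 0"
  defines "\<sigma> \<equiv> s \<bullet> (B *v s)"
  defines "w \<equiv> (1 / sqrt (\<sigma> * (s \<bullet> y))) *\<^sub>R y - (1 / \<sigma>) *\<^sub>R (B *v s)"
  shows "bfgs_update B s y = (mat 1 + outer w s) ** B ** transpose (mat 1 + outer w s)"
    and "det (mat 1 + outer w s) = sqrt ((s \<bullet> y) / \<sigma>)"
proof -
  have "s \<noteq> 0" using sy by auto
  then have \<sigma>: "\<sigma> > 0" unfolding \<sigma>_def by (rule sym_pos_def_pos[OF B])
  define r where "r = sqrt (\<sigma> * (s \<bullet> y))"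
  have r: "r > 0" and r2: "r * r = \<sigma> * (s \<bullet> y)"
    using \<sigma> sy by (simp_all add: r_def)
  have w: "w = (1 / r) *\<^sub>R y - (1 / \<sigma>) *\<^sub>R (B *v s)" by (simp add: w_def r_def)
  have tr: "transpose (mat 1 + outer w s) = mat 1 + outer s w"
    by (simp add: vec_eq_iff transpose_def outer_component mat_def mult.commute)
  show "bfgs_update B s y = (mat 1 + outer w s) ** B ** transpose (mat 1 + outer w s)"
    unfolding matrix_eq
  proof
    fix v
    define q where "q = (B *v s) \<bullet> v"
    have sBv: "s \<bullet> (B *v v) = q"
      by (simp add: q_def sym_pos_def_inner_commute[OF B])
    have wv: "w \<bullet> v = (y \<bullet> v) / r - q / \<sigma>"
      by (simp add: w inner_diff_left q_def)
    have "((mat 1 + outer w s) ** B ** transpose (mat 1 + outer w s)) *v v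
      = B *v v + ((w \<bullet> v) *\<^sub>R (B *v s) + (q + (w \<bullet> v) * \<sigma>) *\<^sub>R w)"
      by (simp add: tr matrix_vector_mult_add_rdistrib outer_mult_vec matrix_vector_right_distrib
          matrix_vector_mult_scaleR inner_add_right sBv \<sigma>_def scaleR_add_right scaleR_add_left
          flip: matrix_vector_mul_assoc)
    also have "q + (w \<bullet> v) * \<sigma> = \<sigma> * (y \<bullet> v) / r"
      using \<sigma> by (simp add: wv field_simps)
    also have "(w \<bullet> v) *\<^sub>R (B *v s) + (\<sigma> * (y \<bullet> v) / r) *\<^sub>R w
       = (\<sigma> * (y \<bullet> v) / (r * r)) *\<^sub>R y + ((w \<bullet> v) - (y \<bullet> v) / r) *\<^sub>R (B *v s)"
      using \<sigma> by (simp add: w algebra_simps)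
    also have "(w \<bullet> v) - (y \<bullet> v) / r = - (q / \<sigma>)" by (simp add: wv)
    also have "\<sigma> * (y \<bullet> v) / (r * r) = (y \<bullet> v) / (s \<bullet> y)"
      using \<sigma> sy by (simp add: r2)
    finally show "bfgs_update B s y *v v
      = ((mat 1 + outer w s) ** B ** transpose (mat 1 + outer w s)) *v v"
      by (simp add: bfgs_update_mult_vec[OF B] q_def \<sigma>_def algebra_simps)
  qed
  have "1 + w \<bullet> s = (s \<bullet> y) / r"
    using \<sigma> by (simp add: w inner_diff_right \<sigma>_def inner_commute)
  also have "\<dots> = sqrt ((s \<bullet> y) / \<sigma>)"
    using \<sigma> sy r r2
    by (intro real_sqrt_unique[symmetric]) (simp_all add: power2_eq_square)
  finally show "det (mat 1 + outer w s) = sqrt ((s \<bullet> y) / \<sigma>)"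
    by (simp add: det_identity_plus_outer)
qed

lemma det_bfgs_update:
  assumes "sym_pos_def B" "s \<bullet> y > 0"
  shows "det (bfgs_update B s y) = det B * ((s \<bullet> y) / (s \<bullet> (B *v s)))"
proof -
  have "s \<noteq> 0" using assms(2) by auto
  then have "s \<bullet> (B *v s) > 0" by (rule sym_pos_def_pos[OF assms(1)])
  then have "sqrt ((s \<bullet> y) / (s \<bullet> (B *v s))) * sqrt ((s \<bullet> y) / (s \<bullet> (B *v s)))
      = (s \<bullet> y) / (s \<bullet> (B *v s))"
    using assms(2) by simp
  then show ?thesis
    unfolding bfgs_update_product_form(1)[OF assms] det_mul det_transpose
      bfgs_update_product_form(2)[OF assms]
    by (metis mult.assoc mult.commute)
qed

lemma sym_pos_def_bfgs_update:
  assumes B: "sym_pos_def B" and sy: "s \<bullet> y > 0"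
  shows "sym_pos_def (bfgs_update B s y)"
proof -
  have "s \<noteq> 0" using sy by auto
  then have \<sigma>: "s \<bullet> (B *v s) > 0" by (rule sym_pos_def_pos[OF B])
  obtain A where A: "bfgs_update B s y = A ** B ** transpose A"
      "det A = sqrt ((s \<bullet> y) / (s \<bullet> (B *v s)))"
    using bfgs_update_product_form[OF B sy] by blast
  have "transpose (bfgs_update B s y) = bfgs_update B s y"
    using B by (simp add: A matrix_transpose_mul sym_pos_def_def matrix_mul_assoc)
  moreover have "0 < v \<bullet> (bfgs_update B s y *v v)" if "v \<noteq> 0" for v
  proof -
    have "det (transpose A) \<noteq> 0" using \<sigma> sy by (simp add: A det_transpose)
    then have "transpose A *v v \<noteq> 0"
      using that matrix_left_invertible_ker invertible_det_nz invertible_left_inverse by blast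
    then have "0 < (transpose A *v v) \<bullet> (B *v (transpose A *v v))"
      by (rule sym_pos_def_pos[OF B])
    also have "\<dots> = v \<bullet> (A *v (B *v (transpose A *v v)))"
      by (metis dot_lmul_matrix transpose_matrix_vector)
    finally show ?thesis 
      by (simp add: A matrix_vector_mul_assoc matrix_mul_assoc del: transpose_matrix_vector)
  qed
  ultimately show ?thesis by (simp add: sym_pos_def_def)
qed

lemma trace_bfgs_update:
  assumes "sym_pos_def B"
  shows "trace (bfgs_update B s y)
    = trace B - (norm (B *v s))\<^sup>2 / (s \<bullet> (B *v s)) + (norm y)\<^sup>2 / (s \<bullet> y)"
  unfolding bfgs_update_def bfgs_rank_one_term[OF assms] trace_add trace_sub trace_scaleR
    trace_outer power2_norm_eq_inner
  by simp

text \<open>Measuring gradients in units of \<open>1 / c\<close> scales every Hessian approximation of a run by the same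
  factor. With \<open>c = 1 / L\<close> this moves the potential argument to a gradient with Lipschitz constant
  \<open>1\<close>.\<close>

lemma bfgs_update_scaleR:
  assumes "c > 0"
  shows "bfgs_update (c *\<^sub>R B) s (c *\<^sub>R y) = c *\<^sub>R bfgs_update B s y"
proof -
  have "c *\<^sub>R B ** outer s s ** (c *\<^sub>R B) = (c * c) *\<^sub>R (B ** outer s s ** B)"
    by (simp add: vec_eq_iff matrix_matrix_mult_def sum_distrib_left mult_ac)
  moreover have "outer (c *\<^sub>R y) (c *\<^sub>R y) = (c * c) *\<^sub>R outer y y"
    by (simp add: vec_eq_iff outer_component)
  ultimately show ?thesis
    using assms by (simp add: bfgs_update_def algebra_simps flip: scaleR_matrix_vector_assoc)
qed

section \<open>The potential \<open>\<Psi>\<close>\<close>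

text \<open>With \<open>q = \<parallel>B s\<parallel>\<^sup>2 / (s \<bullet> B s)\<close>, the trace changes by \<open>\<parallel>y\<parallel>\<^sup>2 / (s \<bullet> y) - q\<close> and \<open>- ln det\<close> by
  \<open>ln q\<close> plus the logarithm in the statement. The bound is then \<open>ln q \<le> q - 1\<close>.\<close>

lemma Psi_bfgs_update_le:
  assumes B: "sym_pos_def B" and sy: "s \<bullet> y > 0" and det: "det B > 0"
  shows "Psi (bfgs_update B s y) \<le> Psi B + (norm y)\<^sup>2 / (s \<bullet> y) - 1
    + ln ((s \<bullet> (B *v s))\<^sup>2 / ((norm (B *v s))\<^sup>2 * (s \<bullet> y)))"
proof -
  define \<sigma> n where "\<sigma> = s \<bullet> (B *v s)" and "n = (norm (B *v s))\<^sup>2"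
  have "s \<noteq> 0" using sy by auto
  then have \<sigma>: "\<sigma> > 0" and n: "n > 0"
    using sym_pos_def_pos[OF B] sym_pos_def_mult_nonzero[OF B] by (simp_all add: \<sigma>_def n_def)
  have "ln (n / \<sigma>) \<le> n / \<sigma> - 1" using \<sigma> n by (intro ln_le_minus_one) simp
  moreover have "ln (\<sigma>\<^sup>2 / (n * (s \<bullet> y))) + ln (n / \<sigma>) = - ln ((s \<bullet> y) / \<sigma>)"
    using \<sigma> n sy by (simp add: ln_mult ln_div ln_realpow)
  moreover have "ln (det (bfgs_update B s y)) = ln (det B) + ln ((s \<bullet> y) / \<sigma>)"
    using det \<sigma> sy unfolding det_bfgs_update[OF B sy] \<sigma>_def by (intro ln_mult_pos) simp_all
  ultimately show ?thesis
    by (simp add: Psi_def trace_bfgs_update[OF B] \<sigma>_def n_def)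
qed

text \<open>BFGS reconstructs the identity from any symmetric positive definite matrix in finitely many
  updates with \<open>y = s\<close>, taken along the coordinate vectors. Facts about such matrices can therefore be
  pulled back from the identity through single updates, which replaces diagonalization.\<close>

lemma sym_pos_def_bfgs_induct:
  fixes B :: "real^'n^'n"
  assumes B: "sym_pos_def B" and one: "P (mat 1)"
    and step: "\<And>B s. sym_pos_def B \<Longrightarrow> norm s = 1 \<Longrightarrow> P (bfgs_update B s s) \<Longrightarrow> P B"
  shows "P B"
proof -
  \<comment> \<open>\<open>T\<close> is the set of coordinates along which an update is still to be made.\<close>
  have "P B" if "finite T" "sym_pos_def B" "\<forall>j. j \<notin> T \<longrightarrow> B *v axis j 1 = axis j 1"
    for T and B :: "real^'n^'n"
    using that
  proof (induction T arbitrary: B rule: finite_induct)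
    case empty
    then have "column j B = axis j 1" for j by (simp add: matrix_vector_mult_basis)
    then have "B $ i $ j = mat 1 $ i $ j" for i j
      by (metis (no_types, lifting) axis_def column_def mat_def vec_lambda_beta)
    then have "B = mat 1" by (simp add: vec_eq_iff)
    then show ?case using one by simp
  next
    case (insert i T)
    define e :: "real^'n" where "e = axis i 1"
    have B: "sym_pos_def B" by (rule insert.prems)
    have e: "e \<bullet> e = 1" "e \<noteq> 0" by (simp_all add: e_def inner_axis_axis)
    have "e \<bullet> (B *v e) > 0" by (rule sym_pos_def_pos[OF B e(2)])
    then have fix_e: "bfgs_update B e e *v e = e"
      by (simp add: bfgs_update_mult_vec[OF B] e inner_commute)
    have "bfgs_update B e e *v axis j 1 = axis j 1" if "j \<notin> T" for j
    proof (cases "j = i")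
      case True
      then show ?thesis using fix_e by (simp add: e_def)
    next
      case False
      then have Bj: "B *v axis j 1 = axis j 1" and ej: "e \<bullet> axis j 1 = 0"
        using insert.prems that by (simp_all add: e_def inner_axis_axis)
      \<comment> \<open>Orthogonality of \<open>B e\<close> to the fixed vector makes both rank-one terms vanish on it.\<close>
      have "(B *v e) \<bullet> axis j 1 = 0"
        using ej by (simp flip: sym_pos_def_inner_commute[OF B] add: Bj)
      then show ?thesis by (simp add: bfgs_update_mult_vec[OF B] Bj ej)
    qed
    moreover have "sym_pos_def (bfgs_update B e e)"
      by (rule sym_pos_def_bfgs_update[OF B]) (simp add: e)
    ultimately have "P (bfgs_update B e e)" by (intro insert.IH) auto
    then show "P B" by (rule step[OF B, of e, rotated]) (simp add: e_def)
  qed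
  from this[of UNIV B, OF _ B] show ?thesis by simp
qed

lemma sym_pos_def_det_pos:
  assumes "sym_pos_def B"
  shows "det B > 0"
  using assms
proof (rule sym_pos_def_bfgs_induct)
  fix B :: "real^'n^'n" and s
  assume B: "sym_pos_def B" and s: "norm s = 1" and "det (bfgs_update B s s) > 0"
  have "s \<bullet> s = 1" using s by (simp add: norm_eq_1)
  moreover have "s \<bullet> (B *v s) > 0" by (rule sym_pos_def_pos[OF B]) (use s in auto)
  ultimately show "det B > 0"
    using \<open>det (bfgs_update B s s) > 0\<close> det_bfgs_update[OF B, of s s]
    by (simp add: zero_less_divide_iff)
qed simp

text \<open>For a unit vector \<open>s\<close> and \<open>y = s\<close>, the bound on the growth of \<open>\<Psi>\<close> is the logarithm of the squared
  cosine of the angle between \<open>s\<close> and \<open>B s\<close>. By Cauchy-Schwarz \<open>\<Psi>\<close> does not increase on the way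
  to the identity, where it vanishes.\<close>

lemma sym_pos_def_Psi_nonneg:
  assumes "sym_pos_def B"
  shows "Psi B \<ge> 0"
  using assms
proof (rule sym_pos_def_bfgs_induct)
  show "Psi (mat 1 :: real^'n^'n) \<ge> 0" by (simp add: Psi_def trace_I)
next
  fix B :: "real^'n^'n" and s
  assume B: "sym_pos_def B" and s: "norm s = 1" and "Psi (bfgs_update B s s) \<ge> 0"
  have ss: "s \<bullet> s = 1" using s by (simp add: norm_eq_1)
  have \<sigma>: "s \<bullet> (B *v s) > 0" by (rule sym_pos_def_pos[OF B]) (use s in auto)
  have "s \<noteq> 0" using s by auto
  then have n: "norm (B *v s) > 0" using sym_pos_def_mult_nonzero[OF B] by simp
  have "s \<bullet> (B *v s) \<le> norm (B *v s)"
    using norm_cauchy_schwarz[of s "B *v s"] s by simp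
  then have "(s \<bullet> (B *v s))\<^sup>2 / (norm (B *v s))\<^sup>2 \<le> 1"
    using \<sigma> n by (simp add: power_mono)
  then have "ln ((s \<bullet> (B *v s))\<^sup>2 / (norm (B *v s))\<^sup>2) \<le> 0"
    using \<sigma> n by (subst ln_le_zero_iff) auto
  then show "Psi B \<ge> 0"
    using Psi_bfgs_update_le[OF B, of s s] sym_pos_def_det_pos[OF B] \<open>Psi (bfgs_update B s s) \<ge> 0\<close>
    by (simp add: ss s)
qed

section \<open>Smooth strongly convex functions\<close>

lemma twice_differentiable_gderiv:
  fixes f :: "'a::euclidean_space \<Rightarrow> real"
  assumes "twice_differentiable f"
  shows "GDERIV f x :> grad f x"
proof -
  obtain f' where f': "(f has_derivative f') (at x)"
    using assms by (auto simp: twice_differentiable_def differentiable_def)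
  then have "linear f'" by (simp add: has_derivative_linear)
  then have "f' = (\<lambda>h. h \<bullet> adjoint f' 1)"
    using adjoint_works[of f' _ 1] by (simp add: fun_eq_iff)
  then have "GDERIV f x :> adjoint f' 1"
    using f' by (simp add: gderiv_def)
  then show ?thesis using grad_eq by metis
qed

lemma gderiv_along_line:
  fixes f :: "'a::real_inner \<Rightarrow> real"
  assumes "GDERIV f (x + u *\<^sub>R h) :> D"
  shows "((\<lambda>u. f (x + u *\<^sub>R h)) has_real_derivative D \<bullet> h) (at u)"
proof -
  have "((\<lambda>u. x + u *\<^sub>R h) has_derivative (\<lambda>v. v *\<^sub>R h)) (at u)"
    by (auto intro!: derivative_eq_intros)
  moreover have "(f has_derivative (\<lambda>h. h \<bullet> D)) (at (x + u *\<^sub>R h))"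
    using assms by (simp add: gderiv_def)
  ultimately have "((\<lambda>u. f (x + u *\<^sub>R h)) has_derivative (\<lambda>v. (v *\<^sub>R h) \<bullet> D)) (at u)"
    by (rule has_derivative_compose)
  moreover have "(\<lambda>v. (v *\<^sub>R h) \<bullet> D) = (*) (D \<bullet> h)"
    by (simp add: fun_eq_iff inner_commute mult.commute)
  ultimately show ?thesis by (simp add: has_field_derivative_def)
qed

text \<open>The defining inequality on the segment from \<open>x\<close> to \<open>y\<close> bounds the difference quotient of \<open>f\<close> at
  \<open>x\<close>; the quadratic term survives with its full coefficient as the quotient tends to the derivative.\<close>

lemma strongly_convex_first_order:
  fixes f :: "'a::real_inner \<Rightarrow> real"
  assumes sc: "strongly_convex \<mu> f" and D: "GDERIV f x :> D"
  shows "f x + D \<bullet> (y - x) + \<mu> / 2 * (norm (y - x))\<^sup>2 \<le> f y"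
proof -
  define h where "h = y - x"
  define n where "n = (norm h)\<^sup>2"
  have "((\<lambda>u. f (x + u *\<^sub>R h)) has_real_derivative D \<bullet> h) (at 0)"
    by (rule gderiv_along_line) (simp add: D)
  then have "((\<lambda>v. (f (x + v *\<^sub>R h) - f x) / v) \<longlongrightarrow> D \<bullet> h) (at_right 0)"
    by (intro filterlim_mono[OF _ order_refl at_le[of "{0<..}" UNIV]])
      (simp_all add: DERIV_def)
  moreover have "((\<lambda>v. f y - f x - \<mu> / 2 * (1 - v) * n) \<longlongrightarrow> f y - f x - \<mu> / 2 * (1 - 0) * n)
      (at_right 0)"
    by (intro tendsto_intros)
  moreover have "\<forall>\<^sub>F v in at_right 0. (f (x + v *\<^sub>R h) - f x) / v \<le> f y - f x - \<mu> / 2 * (1 - v) * n"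
    using eventually_at_right_less[of 0] eventually_at_right_real[of 0 1, simplified]
  proof eventually_elim
    case (elim v)
    have "f ((1 - v) *\<^sub>R x + v *\<^sub>R y) \<le> (1 - v) * f x + v * f y
        - \<mu> / 2 * (1 - v) * v * (norm (x - y))\<^sup>2"
      using sc elim by (simp add: strongly_convex_def)
    moreover have "(1 - v) *\<^sub>R x + v *\<^sub>R y = x + v *\<^sub>R h"
      by (simp add: h_def algebra_simps)
    ultimately have "f (x + v *\<^sub>R h) - f x \<le> (f y - f x - \<mu> / 2 * (1 - v) * n) * v"
      by (simp add: n_def h_def norm_minus_commute algebra_simps)
    then show ?case using elim by (simp add: pos_divide_le_eq)
  qed
  ultimately have "D \<bullet> h \<le> f y - f x - \<mu> / 2 * (1 - 0) * n"
    by (intro tendsto_le[OF trivial_limit_at_right_real])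
  then show ?thesis by (simp add: h_def n_def)
qed

text \<open>The Polyak-Lojasiewicz inequality: the quadratic lower bound at \<open>x\<close> is minimized over all \<open>y\<close> by
  completing the square.\<close>

lemma strongly_convex_gap_le_grad:
  fixes f :: "'a::real_inner \<Rightarrow> real"
  assumes "strongly_convex \<mu> f" "GDERIV f x :> D" "\<mu> > 0"
  shows "f x - f y \<le> (norm D)\<^sup>2 / (2 * \<mu>)"
proof -
  define h where "h = y - x"
  have "0 \<le> (norm (D + \<mu> *\<^sub>R h))\<^sup>2 / (2 * \<mu>)" using assms(3) by simp
  also have "(norm (D + \<mu> *\<^sub>R h))\<^sup>2 = (norm D)\<^sup>2 + 2 * \<mu> * (D \<bullet> h) + \<mu>\<^sup>2 * (norm h)\<^sup>2"
    unfolding power2_norm_eq_inner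
    by (simp add: inner_add_left inner_add_right inner_commute power2_eq_square)
  also have "\<dots> / (2 * \<mu>) = (norm D)\<^sup>2 / (2 * \<mu>) + D \<bullet> h + \<mu> / 2 * (norm h)\<^sup>2"
    using assms(3) by (simp add: field_simps power2_eq_square)
  finally show ?thesis
    using strongly_convex_first_order[OF assms(1,2), of y] by (simp add: h_def)
qed

lemma lipschitz_grad_upper_bound:
  fixes f :: "'a::real_inner \<Rightarrow> real"
  assumes D: "\<And>x. GDERIV f x :> g x" and lip: "L-lipschitz_on UNIV g"
  shows "f y \<le> f x + g x \<bullet> (y - x) + L / 2 * (norm (y - x))\<^sup>2"
proof -
  define h where "h = y - x"
  define \<phi> where "\<phi> u = f (x + u *\<^sub>R h) - u * (g x \<bullet> h) - L / 2 * u\<^sup>2 * (norm h)\<^sup>2" for u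
  have "\<phi> 1 \<le> \<phi> 0"
  proof (rule DERIV_nonpos_imp_nonincreasing[of 0 1 \<phi>])
    fix u :: real
    assume u: "0 \<le> u" "u \<le> 1"
    have "(\<phi> has_real_derivative g (x + u *\<^sub>R h) \<bullet> h - g x \<bullet> h - L * u * (norm h)\<^sup>2) (at u)"
      unfolding \<phi>_def
      by (rule derivative_eq_intros gderiv_along_line D refl)+ simp
    moreover have "g (x + u *\<^sub>R h) \<bullet> h - g x \<bullet> h - L * u * (norm h)\<^sup>2 \<le> 0"
    proof -
      have "(g (x + u *\<^sub>R h) - g x) \<bullet> h \<le> norm (g (x + u *\<^sub>R h) - g x) * norm h"
        by (rule norm_cauchy_schwarz)
      also have "\<dots> \<le> (L * norm (u *\<^sub>R h)) * norm h"
        using lipschitz_onD[OF lip, of "x + u *\<^sub>R h" x] by (intro mult_right_mono) (auto simp: dist_norm)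
      finally show ?thesis using u by (simp add: inner_diff_left power2_eq_square mult_ac)
    qed
    ultimately show "\<exists>z. (\<phi> has_real_derivative z) (at u) \<and> z \<le> 0" by blast
  qed simp
  then show ?thesis by (simp add: \<phi>_def h_def)
qed

text \<open>The Baillon-Haddad inequality. The upper quadratic model of \<open>f\<close> around \<open>b\<close> must stay above the
  tangent plane at \<open>a\<close>; testing this at the minimizer of their difference gives a lower bound on the
  gap between \<open>f b\<close> and the tangent plane at \<open>a\<close>. Adding the same bound with \<open>a\<close> and \<open>b\<close> exchanged
  cancels the values of \<open>f\<close>.\<close>

lemma lipschitz_grad_cocoercive:
  fixes f :: "'a::real_inner \<Rightarrow> real"
  assumes D: "\<And>x. GDERIV f x :> g x" and lip: "L-lipschitz_on UNIV g" and L: "L > 0"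
    and convex: "\<And>x y. f x + g x \<bullet> (y - x) \<le> f y"
  shows "(norm (g b - g a))\<^sup>2 \<le> L * ((b - a) \<bullet> (g b - g a))"
proof -
  have half: "(norm (g b - g a))\<^sup>2 / (2 * L) \<le> f b - f a - g a \<bullet> (b - a)" for a b
  proof -
    define d where "d = g b - g a"
    define z where "z = b - (1 / L) *\<^sub>R d"
    have "f a + g a \<bullet> (z - a) \<le> f b + g b \<bullet> (z - b) + L / 2 * (norm (z - b))\<^sup>2"
      using convex[of a z] lipschitz_grad_upper_bound[OF D lip, of z b] by linarith
    moreover have "L / 2 * (norm (z - b))\<^sup>2 = L / 2 * ((norm d)\<^sup>2 / L\<^sup>2)"
      using L by (simp add: z_def power_divide)
    moreover have "g b \<bullet> (z - b) = g a \<bullet> (z - a) - g a \<bullet> (b - a) - (norm d)\<^sup>2 / L"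
    proof -
      have "d \<bullet> (z - b) = - ((norm d)\<^sup>2 / L)"
        by (simp add: z_def power2_norm_eq_inner)
      then show ?thesis by (simp add: d_def inner_diff_left inner_diff_right)
    qed
    ultimately have "(norm d)\<^sup>2 / L - L / 2 * ((norm d)\<^sup>2 / L\<^sup>2) \<le> f b - f a - g a \<bullet> (b - a)"
      by linarith
    moreover have "(norm d)\<^sup>2 / L - L / 2 * ((norm d)\<^sup>2 / L\<^sup>2) = (norm d)\<^sup>2 / (2 * L)"
      using L by (simp add: field_simps power2_eq_square)
    ultimately show ?thesis by (simp add: d_def)
  qed
  have "(norm (g b - g a))\<^sup>2 / (2 * L) + (norm (g a - g b))\<^sup>2 / (2 * L)
      \<le> (f b - f a - g a \<bullet> (b - a)) + (f a - f b - g b \<bullet> (a - b))"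
    using half[of b a] half[of a b] by linarith
  also have "(norm (g b - g a))\<^sup>2 / (2 * L) + (norm (g a - g b))\<^sup>2 / (2 * L) = (norm (g b - g a))\<^sup>2 / L"
    using L by (simp add: norm_minus_commute field_simps)
  also have "(f b - f a - g a \<bullet> (b - a)) + (f a - f b - g b \<bullet> (a - b)) = (b - a) \<bullet> (g b - g a)"
    by (simp add: inner_diff_left inner_diff_right inner_commute)
  finally show ?thesis using L by (simp add: field_simps)
qed

section \<open>From a product of ratios to a geometric rate\<close>

text \<open>The arithmetic-geometric mean inequality is used twice: for the \<open>a\<^sub>i\<close>, whose geometric mean is
  at least \<open>exp (- \<Psi> / t)\<close> by hypothesis, and for the factors \<open>1 - c a\<^sub>i\<close>.\<close>

lemma prod_one_minus_le_power:
  fixes a :: "nat \<Rightarrow> real"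
  assumes t: "t \<ge> 1" and a: "\<And>i. i < t \<Longrightarrow> a i > 0" and c: "c \<ge> 0"
    and nonneg: "\<And>i. i < t \<Longrightarrow> 0 \<le> 1 - c * a i"
    and sum: "(\<Sum>i<t. ln (a i)) \<ge> - \<Psi>"
  shows "(\<Prod>i<t. 1 - c * a i) \<le> (1 - exp (- (\<Psi> / real t)) * c) ^ t"
proof -
  let ?P = "\<Prod>i<t. 1 - c * a i"
  have P: "?P \<ge> 0" using nonneg by (intro prod_nonneg) auto
  have prod_pos: "(\<Prod>i<t. a i) > 0" using a by (intro prod_pos) auto
  have "- (\<Psi> / real t) \<le> (\<Sum>i<t. ln (a i)) / real t"
    using divide_right_mono[OF sum, of "real t"] by simp
  then have "exp (- (\<Psi> / real t)) \<le> exp ((\<Sum>i<t. ln (a i)) / real t)" by simp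
  also have "(\<Sum>i<t. ln (a i)) = ln (\<Prod>i<t. a i)"
    using a by (intro ln_prod[symmetric]) (auto simp: less_imp_neq[THEN not_sym])
  also have "exp (\<dots> / real t) = (\<Prod>i<t. a i) powr (1 / real t)"
    using less_imp_neq[OF prod_pos] by (simp only: powr_def if_False times_divide_eq_left mult_1_left) simp
  also have "\<dots> \<le> (\<Sum>i<t. a i / real t)"
    using arith_geom_mean[of "{..<t}" a] a t by (force simp: less_imp_le lessThan_empty_iff)
  finally have mean: "exp (- (\<Psi> / real t)) \<le> (\<Sum>i<t. a i / real t)" .
  have "?P powr (1 / real t) \<le> (\<Sum>i<t. (1 - c * a i) / real t)"
    using arith_geom_mean[of "{..<t}" "\<lambda>i. 1 - c * a i"] nonneg t by (force simp: lessThan_empty_iff)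
  also have "\<dots> = 1 - c * (\<Sum>i<t. a i / real t)"
    using t by (simp add: diff_divide_distrib sum_subtractf sum_distrib_left)
  also have "\<dots> \<le> 1 - exp (- (\<Psi> / real t)) * c"
    using mult_left_mono[OF mean c] by (simp add: mult.commute)
  finally have "(?P powr (1 / real t)) ^ t \<le> (1 - exp (- (\<Psi> / real t)) * c) ^ t"
    by (intro power_mono) simp_all
  moreover have "(z powr (1 / real t)) ^ t = z" if "z \<ge> 0" for z :: real
    using that t by (cases "z = 0") (simp_all add: powr_power)
  ultimately show ?thesis using P by simp
qed

section \<open>Convergence of BFGS\<close>

text \<open>In terms of the step \<open>s\<close> instead of the search direction, the definition of the direction says that
  \<open>B s\<close> is a negative multiple of the gradient. Positive definiteness then makes \<open>s\<close> a descent
  direction, and the curvature condition makes \<open>s \<bullet> y\<close> positive, as the next update requires.\<close>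

lemma bfgs_step_properties:
  fixes f :: "real^'n \<Rightarrow> real"
  assumes B: "sym_pos_def B" and \<eta>: "\<eta> > 0" and g: "grad f x \<noteq> 0"
    and aw: "armijo_wolfe \<alpha> \<beta> f x (bfgs_direction f x B) \<eta>" and \<beta>: "\<beta> < 1"
    and x': "x' = x + \<eta> *\<^sub>R bfgs_direction f x B"
  defines "s \<equiv> x' - x" and "y \<equiv> grad f x' - grad f x"
  shows "B *v s = - \<eta> *\<^sub>R grad f x"
    and "grad f x \<bullet> s < 0"
    and "f x' \<le> f x + \<alpha> * (grad f x \<bullet> s)"
    and "s \<bullet> y \<ge> (1 - \<beta>) * - (grad f x \<bullet> s)"
    and "s \<bullet> y > 0"
proof -
  have s: "s = \<eta> *\<^sub>R bfgs_direction f x B" by (simp add: s_def x')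
  show Bs: "B *v s = - \<eta> *\<^sub>R grad f x"
    using linear_neg[OF matrix_vector_mul_linear[of B]]
    by (simp add: s bfgs_direction_def matrix_vector_mult_scaleR sym_pos_def_mult_matrix_inv[OF B])
  then have "s \<noteq> 0" using \<eta> g by auto
  then have "s \<bullet> (B *v s) > 0" by (rule sym_pos_def_pos[OF B])
  then show neg: "grad f x \<bullet> s < 0"
    using \<eta> by (simp add: Bs inner_commute mult_less_0_iff)
  show "f x' \<le> f x + \<alpha> * (grad f x \<bullet> s)"
    using aw by (simp add: armijo_wolfe_def x' s mult_ac)
  have "\<beta> * (grad f x \<bullet> bfgs_direction f x B) \<le> grad f x' \<bullet> bfgs_direction f x B"
    using aw by (simp add: armijo_wolfe_def x')
  then have "\<eta> * (\<beta> * (grad f x \<bullet> bfgs_direction f x B)) \<le> \<eta> * (grad f x' \<bullet> bfgs_direction f x B)"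
    using \<eta> by (intro mult_left_mono) auto
  then have "\<beta> * (grad f x \<bullet> s) \<le> grad f x' \<bullet> s"
    by (simp add: s mult_ac)
  then show wolfe: "s \<bullet> y \<ge> (1 - \<beta>) * - (grad f x \<bullet> s)"
    by (simp add: y_def inner_diff_right inner_commute algebra_simps)
  have "(1 - \<beta>) * - (grad f x \<bullet> s) > 0" using neg \<beta> by (intro mult_pos_pos) auto
  then show "s \<bullet> y > 0" using wolfe by linarith
qed

lemma bfgs_run_sym_pos_def:
  assumes run: "bfgs_run f \<eta> x B" and \<beta>: "\<beta> < 1"
    and aw: "\<forall>t. armijo_wolfe \<alpha> \<beta> f (x t) (bfgs_direction f (x t) (B t)) (\<eta> t)"
  shows "sym_pos_def (B t)"
proof (induction t)
  case 0
  then show ?case using run by (simp add: bfgs_run_def)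
next
  case (Suc t)
  have "(x (Suc t) - x t) \<bullet> (grad f (x (Suc t)) - grad f (x t)) > 0"
    using run aw by (intro bfgs_step_properties(5)[OF Suc, of "\<eta> t" f "x t" \<alpha> \<beta>] \<beta>)
      (auto simp: bfgs_run_def)
  moreover have "B (Suc t) = bfgs_update (B t) (x (Suc t) - x t) (grad f (x (Suc t)) - grad f (x t))"
    using run by (simp add: bfgs_run_def)
  ultimately show ?case using sym_pos_def_bfgs_update[OF Suc] by simp
qed

text \<open>The numbers \<open>\<phi>\<close> and \<open>\<phi>'\<close> stand for the objective before and after the step, and \<open>r\<close> for
  \<open>s \<bullet> y\<close>. The decrease \<open>- \<alpha> (g \<bullet> s)\<close> is a fixed fraction of the gap because one factor \<open>- (g \<bullet> s)\<close>
  of the square is absorbed by \<open>r\<close>, and \<open>\<parallel>g\<parallel>\<^sup>2\<close> by the upper bound on the gap.\<close>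

lemma suboptimality_contraction:
  fixes \<phi> \<phi>' \<phi>min r \<mu> \<alpha> \<beta> :: real and g s :: "'a::real_inner"
  assumes "\<mu> > 0" and "0 < \<alpha>" and \<beta>: "\<beta> < 1" and "g \<noteq> 0"
    and neg: "g \<bullet> s < 0"
    and gap: "\<phi> - \<phi>min \<le> (norm g)\<^sup>2 / (2 * \<mu>)"
    and armijo: "\<phi>' \<le> \<phi> + \<alpha> * (g \<bullet> s)"
    and wolfe: "r \<ge> (1 - \<beta>) * - (g \<bullet> s)"
  shows "\<phi>' - \<phi>min \<le> (1 - 2 * \<alpha> * (1 - \<beta>) * \<mu> * ((g \<bullet> s)\<^sup>2 / ((norm g)\<^sup>2 * r))) * (\<phi> - \<phi>min)"
proof -
  define p n where "p = - (g \<bullet> s)" and "n = (norm g)\<^sup>2"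
  have p: "p > 0" and n: "n > 0" using neg \<open>g \<noteq> 0\<close> by (simp_all add: p_def n_def)
  have rp: "(1 - \<beta>) * p \<le> r" using wolfe by (simp add: p_def)
  have "0 < (1 - \<beta>) * p" using \<beta> p by simp
  with rp have r: "r > 0" by linarith
  have "2 * \<alpha> * (1 - \<beta>) * \<mu> * (p\<^sup>2 / (n * r)) * (\<phi> - \<phi>min)
      \<le> 2 * \<alpha> * (1 - \<beta>) * \<mu> * (p\<^sup>2 / (n * r)) * (n / (2 * \<mu>))"
    using gap assms(1,2) \<beta> n r by (intro mult_left_mono) (auto simp: n_def)
  also have "\<dots> = \<alpha> * p * ((1 - \<beta>) * p / r)"
    using n assms(1) r by (simp add: field_simps power2_eq_square)
  also have "\<dots> \<le> \<alpha> * p"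
    using rp r p assms(2) by (intro mult_left_le) (auto simp: divide_le_eq)
  also have "\<dots> \<le> \<phi> - \<phi>'" using armijo by (simp add: p_def)
  finally show ?thesis by (simp add: p_def n_def algebra_simps)
qed

text \<open>The growth bounds for the potential of \<open>B\<^sub>t / L\<close> telescope, and the potential ends up
  nonnegative. Each logarithm involves \<open>B\<^sub>t\<close> only through the direction of \<open>B\<^sub>t s\<^sub>t\<close>, so the scaling
  leaves just the factor \<open>L\<close> that comes from \<open>y\<^sub>t\<close>.\<close>

lemma bfgs_log_sum_lower_bound:
  fixes B :: "nat \<Rightarrow> real^'n^'n"
  assumes B: "\<And>t. sym_pos_def (B t)" and L: "L > 0"
    and upd: "\<And>t. B (Suc t) = bfgs_update (B t) (s t) (y t)"
    and sy: "\<And>t. s t \<bullet> y t > 0"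
    and coco: "\<And>t. (norm (y t))\<^sup>2 \<le> L * (s t \<bullet> y t)"
  shows "(\<Sum>i<t. ln (L * ((s i \<bullet> (B i *v s i))\<^sup>2 / ((norm (B i *v s i))\<^sup>2 * (s i \<bullet> y i)))))
    \<ge> - Psi ((1 / L) *\<^sub>R B 0)"
proof -
  define C where "C t = (1 / L) *\<^sub>R B t" for t
  have C: "sym_pos_def (C t)" for t
    unfolding C_def using B L by (intro sym_pos_def_scaleR) auto
  let ?a = "\<lambda>i. L * ((s i \<bullet> (B i *v s i))\<^sup>2 / ((norm (B i *v s i))\<^sup>2 * (s i \<bullet> y i)))"
  have step: "Psi (C (Suc i)) \<le> Psi (C i) + ln (?a i)" for i
  proof -
    define z where "z = (1 / L) *\<^sub>R y i"
    have "C (Suc i) = bfgs_update (C i) (s i) z"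
      unfolding C_def upd z_def using L by (simp only: bfgs_update_scaleR zero_less_divide_1_iff)
    moreover have "s i \<bullet> z > 0" using sy[of i] L by (simp add: z_def)
    ultimately have "Psi (C (Suc i)) \<le> Psi (C i) + (norm z)\<^sup>2 / (s i \<bullet> z) - 1
        + ln ((s i \<bullet> (C i *v s i))\<^sup>2 / ((norm (C i *v s i))\<^sup>2 * (s i \<bullet> z)))"
      using Psi_bfgs_update_le[OF C _ sym_pos_def_det_pos[OF C]] by simp
    moreover have "(norm z)\<^sup>2 / (s i \<bullet> z) \<le> 1"
    proof -
      have "(norm z)\<^sup>2 / (s i \<bullet> z) = (norm (y i))\<^sup>2 / (L * (s i \<bullet> y i))"
        using L by (simp add: z_def power_divide power2_eq_square)
      also have "\<dots> \<le> 1" using coco[of i] sy[of i] L by (simp add: divide_le_eq)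
      finally show ?thesis .
    qed
    moreover have "(s i \<bullet> (C i *v s i))\<^sup>2 / ((norm (C i *v s i))\<^sup>2 * (s i \<bullet> z)) = ?a i"
    proof -
      have "C i *v s i = (1 / L) *\<^sub>R (B i *v s i)"
        by (simp only: C_def scaleR_matrix_vector_assoc)
      then show ?thesis using L by (simp add: z_def power_divide power2_eq_square)
    qed
    ultimately show ?thesis by simp
  qed
  have "Psi (C t) \<le> Psi (C 0) + (\<Sum>i<t. ln (?a i))"
  proof (induction t)
    case (Suc t)
    then show ?case using step[of t] by simp
  qed simp
  then show ?thesis using sym_pos_def_Psi_nonneg[OF C, of t] by (simp add: C_def)
qed

theorem theorem4p1:
  fixes f :: "real^'n \<Rightarrow> real"
    and \<mu> L \<kappa> \<alpha> \<beta> :: real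
    and xmin :: "real^'n"
    and \<eta> :: "nat \<Rightarrow> real"
    and x :: "nat \<Rightarrow> real^'n"
    and B :: "nat \<Rightarrow> real^'n^'n"
  assumes "twice_differentiable f"
    and "\<mu> > 0" and "strongly_convex \<mu> f"
    and "L > 0" and "L-lipschitz_on UNIV (grad f)"
    and "\<kappa> = L / \<mu>"
    and "is_arg_min f (\<lambda>_. True) xmin"
    and "0 < \<alpha>" and "\<alpha> < \<beta>" and "\<beta> < 1" and "\<alpha> < 1 / 2"
    and "bfgs_run f \<eta> x B"
    and "\<forall>t. armijo_wolfe \<alpha> \<beta> f (x t) (bfgs_direction f (x t) (B t)) (\<eta> t)"
  shows "\<forall>t\<ge>1. (f (x t) - f xmin) / (f (x 0) - f xmin)
           \<le> (1 - exp (- (Psi ((1 / L) *\<^sub>R B 0) / real t)) * (2 * \<alpha> * (1 - \<beta>) / \<kappa>)) ^ t"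
proof (intro allI impI)
  fix t :: nat
  assume t: "t \<ge> 1"
  note \<mu> = assms(2) and L = assms(4) and \<alpha> = assms(8) and \<beta> = assms(10)
  define g where "g i = grad f (x i)" for i
  define s where "s i = x (Suc i) - x i" for i
  define y where "y i = g (Suc i) - g i" for i
  define \<delta> where "\<delta> i = f (x i) - f xmin" for i
  define a where "a i = L * ((g i \<bullet> s i)\<^sup>2 / ((norm (g i))\<^sup>2 * (s i \<bullet> y i)))" for i
  define c where "c = 2 * \<alpha> * (1 - \<beta>) / \<kappa>"
  have D: "GDERIV f z :> grad f z" for z
    by (rule twice_differentiable_gderiv[OF assms(1)])
  have first_order: "f z + grad f z \<bullet> (z' - z) + \<mu> / 2 * (norm (z' - z))\<^sup>2 \<le> f z'" for z z'
    by (rule strongly_convex_first_order[OF assms(3) D])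
  have convex: "f z + grad f z \<bullet> (z' - z) \<le> f z'" for z z'
    using first_order[of z z'] \<mu> by (smt (verit) divide_nonneg_nonneg mult_nonneg_nonneg zero_le_power2)
  have min: "f xmin \<le> f z" for z
    using assms(7) by (auto simp: is_arg_min_def not_less)
  have spd: "sym_pos_def (B i)" for i
    by (rule bfgs_run_sym_pos_def[OF assms(12) \<beta> assms(13)])
  have run: "grad f (x i) \<noteq> 0" "\<eta> i > 0"
      "x (Suc i) = x i + \<eta> i *\<^sub>R bfgs_direction f (x i) (B i)"
      "B (Suc i) = bfgs_update (B i) (s i) (y i)" for i
    using assms(12) by (simp_all add: bfgs_run_def s_def y_def g_def)
  note step = bfgs_step_properties[OF spd run(2,1) assms(13)[rule_format] \<beta> run(3),
      folded s_def g_def, folded y_def]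
  have g: "g i \<noteq> 0" for i using run(1) by (simp add: g_def)
  have a_pos: "a i > 0" for i
    using L g[of i] step(2)[of i] step(5)[of i] by (simp add: a_def)
  have \<delta>_pos: "\<delta> i > 0" for i
  proof -
    \<comment> \<open>A point attaining the minimal value would have zero gradient.\<close>
    have "f (x i) \<noteq> f xmin"
    proof
      assume "f (x i) = f xmin"
      then have "f (x i) \<le> f z" for z using min by simp
      moreover have "(f has_derivative (\<lambda>h. h \<bullet> g i)) (at (x i))"
        using D[of "x i"] by (simp add: gderiv_def g_def)
      ultimately have "(\<lambda>h. h \<bullet> g i) = (\<lambda>h. 0)"
        by (intro has_derivative_local_min) auto
      then have "g i \<bullet> g i = 0" by metis
      then show False using g[of i] by simp
    qed
    then show ?thesis using min[of "x i"] by (simp add: \<delta>_def)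
  qed
  have contraction: "\<delta> (Suc i) \<le> (1 - c * a i) * \<delta> i" for i
  proof -
    have "f (x i) - f xmin \<le> (norm (g i))\<^sup>2 / (2 * \<mu>)"
      unfolding g_def by (rule strongly_convex_gap_le_grad[OF assms(3) D \<mu>])
    from suboptimality_contraction[OF \<mu> \<alpha> \<beta> g step(2) this step(3,4)]
    show ?thesis using L \<mu> by (simp add: \<delta>_def c_def a_def assms(6) mult_ac)
  qed
  \<comment> \<open>The gap stays positive, so the contraction factor cannot be negative.\<close>
  have factor_nonneg: "0 \<le> 1 - c * a i" for i
  proof -
    have "0 < (1 - c * a i) * \<delta> i" using contraction[of i] \<delta>_pos[of "Suc i"] by linarith
    then show ?thesis using \<delta>_pos[of i] by (simp add: zero_less_mult_iff)
  qed
  have "\<delta> t \<le> (\<Prod>i<t. 1 - c * a i) * \<delta> 0" for t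
  proof (induction t)
    case (Suc t)
    have "\<delta> (Suc t) \<le> (1 - c * a t) * ((\<Prod>i<t. 1 - c * a i) * \<delta> 0)"
      using contraction[of t] mult_left_mono[OF Suc factor_nonneg[of t]] by linarith
    then show ?case by (simp add: mult_ac)
  qed simp
  then have "\<delta> t / \<delta> 0 \<le> (\<Prod>i<t. 1 - c * a i)"
    using \<delta>_pos[of 0] by (simp add: divide_le_eq)
  also have "\<dots> \<le> (1 - exp (- (Psi ((1 / L) *\<^sub>R B 0) / real t)) * c) ^ t"
  proof (rule prod_one_minus_le_power[OF t a_pos _ factor_nonneg])
    show "c \<ge> 0" using \<alpha> \<beta> L \<mu> by (simp add: c_def assms(6))
    have "(norm (y i))\<^sup>2 \<le> L * (s i \<bullet> y i)" for i
      unfolding y_def s_def g_def by (rule lipschitz_grad_cocoercive[OF D assms(5) L convex])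
    note potential = bfgs_log_sum_lower_bound[where B = B and s = s and y = y and t = t,
        OF spd L run(4) step(5) this]
    \<comment> \<open>\<open>B\<^sub>i s\<^sub>i\<close> is a multiple of \<open>g\<^sub>i\<close>, so the step size cancels from the quotient.\<close>
    have "(s i \<bullet> (B i *v s i))\<^sup>2 / ((norm (B i *v s i))\<^sup>2 * (s i \<bullet> y i))
        = (g i \<bullet> s i)\<^sup>2 / ((norm (g i))\<^sup>2 * (s i \<bullet> y i))" for i
      using run(2)[of i] by (simp add: step(1) power_mult_distrib inner_commute)
    then show "(\<Sum>i<t. ln (a i)) \<ge> - Psi ((1 / L) *\<^sub>R B 0)"
      using potential by (simp add: a_def)
  qed
  finally show "(f (x t) - f xmin) / (f (x 0) - f xmin)
      \<le> (1 - exp (- (Psi ((1 / L) *\<^sub>R B 0) / real t)) * (2 * \<alpha> * (1 - \<beta>) / \<kappa>)) ^ t"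
    by (simp add: \<delta>_def c_def)
qed

end
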